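(* If a tree $T$ of order $n\ge 6$ and leaf order $\ell$ satisfies $\iota (T)=\frac {n+\ell}{4}$, then $T\in \mathcal{F}$.
   Context: Graphs are finite and simple. A leaf is a vertex of degree $1$; the leaf order is the number of leaves; the order is the number of vertices. For $D\subseteq V(G)$, $N[D]$ is the set consisting of the vertices of $D$ and all their neighbours. An isolating set of $G$ is a set $D\subseteq V(G)$ such that $G-N[D]$ has no edges. The isolation number $\iota(G)$ is the size of a smallest isolating set of $G$. The family $\mathcal{F}$ of trees: Consider copies of a path of order $3$ with one leaf labeled $a$, the other leaf labeled $c$ and the vertex of degree $2$ labeled $b$, and copies of a path of order $4$ with the two leaves labeled $x$ and the two vertices of degree $2$ labeled $y$, all copies being pairwise vertex-disjoint. Let $A,B,C,X,Y$ be the sets of vertices of these copies labeled $a,b,c,x,y$, respectively. A tree $T$ belongs to $\mathcal{F}$ if and only if $T$ can be obtained from $r\ge 2$ copies of the path of order $3$ and $s\ge 0$ copies of the path of order $4$ by adding edges with endpoints in $A\cup X$ so that no vertex in $A\cup X$ remains a leaf in $T$ (that is, the leaves of $T$ are the vertices in $C$). *)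

theory Defs
  imports Complex_Main "Graph_Theory.Graph_Theory"
begin

text \<open>
  Finite simple graphs are the instances of the locale \<^locale>\<open>pair_graph\<close>: finite loopless symmetric
  digraphs whose arcs are pairs of vertices, so that an edge between \<open>u\<close> and \<open>v\<close> is represented by
  the two arcs \<open>(u, v)\<close> and \<open>(v, u)\<close>.
\<close>

text \<open>
  The notion of tree in Graph_Theory does not fit symmetric digraphs, because there the
  closed walk \<open>u, v, u\<close> along a single edge counts as a cycle. The cycles of an undirected simple
  graph are the directed ones of length at least 3. Connected graphs are nonempty.
\<close>

definition undirected_tree :: "'a pair_pre_digraph \<Rightarrow> bool" where
  "undirected_tree T \<longleftrightarrow>
     pair_graph T \<and> Digraph_Component.connected T \<and>
     \<not> (\<exists>p. pre_digraph.cycle T p \<and> 3 \<le> length p)"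

text \<open>In a symmetric digraph, the out-degree of a vertex is its undirected degree.\<close>

definition leaves :: "'a pair_pre_digraph \<Rightarrow> 'a set" where
  "leaves G = {v \<in> pverts G. out_degree G v = 1}"

definition closed_neighbourhood :: "'a pair_pre_digraph \<Rightarrow> 'a set \<Rightarrow> 'a set" where
  "closed_neighbourhood G D = D \<union> {v. \<exists>u\<in>D. (u, v) \<in> parcs G}"

definition isolating_set :: "'a pair_pre_digraph \<Rightarrow> 'a set \<Rightarrow> bool" where
  "isolating_set G D \<longleftrightarrow>
     D \<subseteq> pverts G \<and> arcs (with_proj G \<restriction> (pverts G - closed_neighbourhood G D)) = {}"

definition isolation_number :: "'a pair_pre_digraph \<Rightarrow> nat" where
  "isolation_number G = (LEAST k. \<exists>D. isolating_set G D \<and> card D = k)"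


text \<open>
  Vertices of the disjoint copies: copy \<open>i\<close> of the path of order 3 is \<open>VA i, VB i, VC i\<close>, and
  copy \<open>j\<close> of the path of order 4 is \<open>VX j False, VY j False, VY j True, VX j True\<close>.
\<close>

datatype copy_vertex = VA nat | VB nat | VC nat | VX nat bool | VY nat bool

definition copies_vertices :: "nat \<Rightarrow> nat \<Rightarrow> copy_vertex set" where
  "copies_vertices r s =
     (\<Union>i<r. {VA i, VB i, VC i}) \<union>
     (\<Union>j<s. {VX j False, VY j False, VY j True, VX j True})"

text \<open>One orientation of each path edge; \<^const>\<open>mk_symmetric\<close> below adds the other one.\<close>

definition copies_arcs :: "nat \<Rightarrow> nat \<Rightarrow> (copy_vertex \<times> copy_vertex) set" where
  "copies_arcs r s =
     (\<Union>i<r. {(VA i, VB i), (VB i, VC i)}) \<union>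
     (\<Union>j<s. {(VX j False, VY j False), (VY j False, VY j True), (VY j True, VX j True)})"

definition attachment_vertices :: "nat \<Rightarrow> nat \<Rightarrow> copy_vertex set" where
  "attachment_vertices r s = (\<Union>i<r. {VA i}) \<union> (\<Union>j<s. {VX j False, VX j True})"

definition join_copies ::
  "nat \<Rightarrow> nat \<Rightarrow> (copy_vertex \<times> copy_vertex) set \<Rightarrow> copy_vertex pair_pre_digraph" where
  "join_copies r s E =
     mk_symmetric (with_proj \<lparr>pverts = copies_vertices r s, parcs = copies_arcs r s \<union> E\<rparr>)"

text \<open>
  The family is closed under isomorphism. The requirement that \<open>T\<close> is a tree also rules out
  loops in \<open>E\<close>.
\<close>

definition family_F :: "'a pair_pre_digraph set" where
  "family_F = {T. undirected_tree T \<and>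
     (\<exists>r s E. 2 \<le> r \<and>
        E \<subseteq> attachment_vertices r s \<times> attachment_vertices r s \<and>
        attachment_vertices r s \<inter> leaves (join_copies r s E) = {} \<and>
        digraph_iso (with_proj (join_copies r s E)) (with_proj T))}"

end

theory Submission
  imports Defs
begin

text \<open>
  Root \<open>T\<close> at one of its leaves and run the tree dynamic programme for isolating sets. For a rooted
  tree \<open>t\<close> with apex \<open>v\<close> and a selected set \<open>D\<close> there are four increasingly strong demands: every link
  is isolated provided that \<open>v\<close> is dominated from above (level 0); every link is isolated (level 1);
  moreover \<open>v\<close> is dominated (level 2); moreover \<open>v \<in> D\<close> (level 3). Let \<open>m\<^sub>0 \<le> m\<^sub>1 \<le> m\<^sub>2 \<le> m\<^sub>3\<close> be the
  least sizes. Adding \<open>v\<close> to a set of level 0 gives one of level 3, so \<open>m\<^sub>3 \<le> m\<^sub>0 + 1\<close>, and therefore the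
  four numbers are determined by their sum \<open>q\<close>, as \<open>m\<^sub>j = (q + j) div 4\<close>. The recursion for the \<open>m\<^sub>j\<close>
  becomes a recursion for the single number \<open>q\<close> (\<^term>\<open>quad_cost\<close>, with residue \<^term>\<open>phase\<close> modulo
  4); sets of these sizes are constructed in \<open>ex_secures\<close>.

  Compare \<open>q\<close> with the number of nodes plus the number of childless nodes. One step of the recursion
  increases \<open>q\<close>, relative to the sum over the children, by at most 1 at an inner node and at most 2 at
  a tip (\<open>quad_cost_step\<close>). Hence \<open>q \<le> \<close>\<^term>\<open>weight\<close>, and above a leaf root this gives
  \<open>4 * \<iota>(T) \<le> n + l\<close>. If equality holds, no step along the way loses anything, which dictates the phases
  of the children of every node:

    \<^item> a node of phase 0 has one child of phase 3, and all its other children have phase 0;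
    \<^item> a node of phase 3 has exactly one child, of phase 2;
    \<^item> a node of phase 2 is a tip or has exactly one child, of phase 1;
    \<^item> a node of phase 1 has children, all of phase 0.

  A node of phase 0 with its phase-3 child and the phase-2 node below is thus a path \<open>a, b, c\<close> if the
  last node is a tip, and otherwise the first three vertices of a path \<open>x, y, y, x\<close> that ends in a node
  of phase 1. Read upwards, the chosen leaf root, its child (of phase 2) and its grandchild (of phase 1)
  form one more path \<open>c, b, a\<close>. All other links join vertices of phase 0 or 1, that is, endpoints \<open>a\<close> or
  \<open>x\<close>, and each of these has both a parent and a child, so that none of them is a leaf. This is the
  description of \<^term>\<open>family_F\<close>.
\<close>

section \<open>Rooted trees\<close>

datatype 'a rtree = Node (apex: 'a) "'a rtree list"

primrec nodes :: "'a rtree \<Rightarrow> 'a list" where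
  "nodes (Node x ts) = x # concat (map nodes ts)"

text \<open>
  In a rooted representation of a tree with at least two vertices the tips are its leaves, except that
  the apex is a leaf as well if it has exactly one child.
\<close>

primrec tips :: "'a rtree \<Rightarrow> 'a list" where
  "tips (Node x ts) = (if ts = [] then [x] else concat (map tips ts))"

fun links :: "'a rtree \<Rightarrow> ('a \<times> 'a) set" where
  "links (Node x ts) = (\<lambda>t. (x, apex t)) ` set ts \<union> (\<Union>t\<in>set ts. links t)"

lemma apex_in_nodes: "apex t \<in> set (nodes t)"
  by (cases t) auto

lemma links_subset: "links t \<subseteq> set (nodes t) \<times> set (nodes t)"
  by (induction t) (use apex_in_nodes in fastforce)

lemma nodes_reachable: "v \<in> set (nodes t) \<Longrightarrow> (apex t, v) \<in> (links t)\<^sup>*"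
proof (induction t)
  case (Node x ts)
  show ?case
  proof (cases "v = x")
    case False
    then obtain s where s: "s \<in> set ts" "v \<in> set (nodes s)"
      using Node.prems by auto
    have "links s \<subseteq> links (Node x ts)"
      using s(1) by auto
    then have "(apex s, v) \<in> (links (Node x ts))\<^sup>*"
      using Node.IH[OF s] rtrancl_mono by blast
    moreover have "(x, apex s) \<in> links (Node x ts)"
      using s(1) by auto
    ultimately show ?thesis
      by (simp del: links.simps add: converse_rtrancl_into_rtrancl)
  qed simp
qed

lemma ex_attach:
  "p \<in> set (nodes t) \<Longrightarrow>
   \<exists>t'. apex t' = apex t \<and> mset (nodes t') = add_mset v (mset (nodes t)) \<and> links t' = insert (p, v) (links t)"
proof (induction t)
  case (Node x ts)
  show ?case
  proof (cases "p = x")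
    case True
    then show ?thesis
      by (intro exI[of _ "Node x (Node v [] # ts)"]) auto
  next
    case False
    then obtain s where s: "s \<in> set ts" "p \<in> set (nodes s)"
      using Node.prems by auto
    then obtain us vs where ts: "ts = us @ s # vs"
      by (meson split_list)
    obtain s' where "apex s' = apex s" "mset (nodes s') = add_mset v (mset (nodes s))"
      "links s' = insert (p, v) (links s)"
      using Node.IH[OF s] by blast
    then show ?thesis
      unfolding ts by (intro exI[of _ "Node x (us @ s' # vs)"]) auto
  qed
qed

lemma distinct_concat_unique:
  assumes "distinct (concat (map f ts))" "s \<in> set ts" "s' \<in> set ts"
    "v \<in> set (f s)" "v \<in> set (f s')"
  shows "s = s'"
  using assms by (induction ts) auto

lemma distinct_nodes_child: "distinct (nodes (Node x ts)) \<Longrightarrow> t \<in> set ts \<Longrightarrow> distinct (nodes t)"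
  by (induction ts) auto

lemma link_child_not_apex:
  assumes "distinct (nodes t)" "(u, v) \<in> links t"
  shows "v \<noteq> apex t"
proof (cases t)
  case (Node x ts)
  then have "v \<in> set (concat (map nodes ts))"
    using assms(2) apex_in_nodes links_subset by fastforce
  with assms(1) Node show ?thesis by auto
qed

lemma parent_unique:
  "distinct (nodes t) \<Longrightarrow> (u, v) \<in> links t \<Longrightarrow> (u', v) \<in> links t \<Longrightarrow> u = u'"
proof (induction t)
  case (Node x ts)
  have d: "distinct (concat (map nodes ts))"
    using Node.prems(1) by simp
  have par: "\<exists>s\<in>set ts. v \<in> set (nodes s) \<and> (w = x \<and> v = apex s \<or> (w, v) \<in> links s)"
    if "(w, v) \<in> links (Node x ts)" for w
    using that apex_in_nodes links_subset by fastforce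
  obtain s s' where s: "s \<in> set ts" "v \<in> set (nodes s)" "u = x \<and> v = apex s \<or> (u, v) \<in> links s"
    and s': "s' \<in> set ts" "v \<in> set (nodes s')" "u' = x \<and> v = apex s' \<or> (u', v) \<in> links s'"
    using par[OF Node.prems(2)] par[OF Node.prems(3)] by blast
  have "s' = s"
    using distinct_concat_unique[OF d s'(1) s(1) s'(2) s(2)] .
  moreover have "distinct (nodes s)"
    using Node.prems(1) s(1) by (rule distinct_nodes_child)
  ultimately show ?case
    using s s' Node.IH[OF s(1)] link_child_not_apex[of s] by blast
qed

lemma ex_parent:
  assumes "v \<in> set (nodes t)" "v \<noteq> apex t"
  shows "\<exists>u. (u, v) \<in> links t"
  using nodes_reachable[OF assms(1)] assms(2) by (metis rtrancl.cases)

lemma set_tips_subset: "set (tips t) \<subseteq> set (nodes t)"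
  by (induction t) auto

lemma tips_nonempty: "tips t \<noteq> []"
proof (induction t)
  case (Node x ts)
  then show ?case by (cases ts) auto
qed

lemma distinct_concat_map_subset:
  assumes "distinct (concat (map f ts))"
    and "\<And>t. t \<in> set ts \<Longrightarrow> distinct (g t) \<and> set (g t) \<subseteq> set (f t)"
  shows "distinct (concat (map g ts))"
  using assms
proof (induction ts)
  case (Cons t ts)
  have "set (concat (map g ts)) \<subseteq> set (concat (map f ts))" "set (g t) \<subseteq> set (f t)"
    using Cons.prems(2) by auto
  moreover have "distinct (f t)" "distinct (concat (map f ts))"
    "set (f t) \<inter> set (concat (map f ts)) = {}"
    using Cons.prems(1) by auto
  ultimately show ?case
    using Cons.IH Cons.prems(2)[of t] Cons.prems(2) by simp blast
qed simp

lemma distinct_tips: "distinct (nodes t) \<Longrightarrow> distinct (tips t)"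
proof (induction t)
  case (Node x ts)
  have "distinct (concat (map tips ts))"
  proof (rule distinct_concat_map_subset)
    show "distinct (concat (map nodes ts))"
      using Node.prems by simp
    show "distinct (tips t) \<and> set (tips t) \<subseteq> set (nodes t)" if "t \<in> set ts" for t
      using Node.IH[OF that distinct_nodes_child[OF Node.prems that]] set_tips_subset[of t] by simp
  qed
  then show ?case by simp
qed

lemma tip_no_child: "distinct (nodes t) \<Longrightarrow> v \<in> set (tips t) \<Longrightarrow> (v, c) \<notin> links t"
proof (induction t)
  case (Node x ts)
  show ?case
  proof (cases "ts = []")
    case False
    then obtain s where s: "s \<in> set ts" "v \<in> set (tips s)"
      using Node.prems(2) by auto
    have vs: "v \<in> set (nodes s)"
      using s(2) set_tips_subset[of s] by auto
    then have "v \<noteq> x"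
      using Node.prems(1) s(1) by auto
    moreover have "(v, c) \<notin> links s'" if "s' \<in> set ts" for s'
    proof
      assume "(v, c) \<in> links s'"
      then have "v \<in> set (nodes s')"
        using links_subset by blast
      then have "s' = s"
        using distinct_concat_unique[of nodes ts s' s v] Node.prems(1) that s(1) vs by simp
      then show False
        using Node.IH[OF s(1) distinct_nodes_child[OF Node.prems(1) s(1)] s(2)]
          \<open>(v, c) \<in> links s'\<close> by simp
    qed
    ultimately show ?thesis by auto
  qed simp
qed

section \<open>Rooting an undirected tree\<close>

definition represents :: "'a rtree \<Rightarrow> 'a pair_pre_digraph \<Rightarrow> bool" where
  "represents t G \<longleftrightarrow> distinct (nodes t) \<and> set (nodes t) = pverts G \<and> parcs G = links t \<union> (links t)\<inverse>"

lemma tree_has_no_extra_arc: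
  assumes T: "undirected_tree T" and t: "set (nodes t) \<subseteq> pverts T" "links t \<subseteq> parcs T"
    and xy: "x \<in> set (nodes t)" "y \<in> set (nodes t)" "(x, y) \<in> parcs T"
  shows "(x, y) \<in> links t \<union> (links t)\<inverse>"
proof (rule ccontr)
  assume new: "(x, y) \<notin> links t \<union> (links t)\<inverse>"
  interpret T: pair_graph T
    using T unfolding undirected_tree_def by blast
  \<comment> \<open>A path from \<open>y\<close> to \<open>x\<close> inside \<open>H\<close> has length at least 2 because \<open>x \<noteq> y\<close> and \<open>(y, x)\<close> is
    not an arc of \<open>H\<close>; the arc \<open>(x, y)\<close> closes it to a cycle.\<close>
  define H where "H = \<lparr>pverts = set (nodes t), parcs = links t \<union> (links t)\<inverse>\<rparr>"
  interpret H: pair_wf_digraph H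
    using links_subset[of t] unfolding H_def by unfold_locales auto
  have HT: "pverts H \<subseteq> pverts T" "parcs H \<subseteq> parcs T"
    using t T.arcs_symmetric unfolding H_def by auto
  have "(y, apex t) \<in> (parcs H)\<^sup>*"
    using nodes_reachable[OF xy(2)] rtrancl_mono[of "(links t)\<inverse>" "parcs H"]
    by (auto simp: H_def rtrancl_converse)
  moreover have "(apex t, x) \<in> (parcs H)\<^sup>*"
    using nodes_reachable[OF xy(1)] rtrancl_mono[of "links t" "parcs H"] by (auto simp: H_def)
  ultimately have "(y, x) \<in> (parcs H)\<^sup>*"
    by (rule rtrancl_trans)
  then have "y \<rightarrow>\<^sup>*\<^bsub>with_proj H\<^esub> x"
  proof induction
    case base
    show ?case using xy(2) by (intro H.reachable_refl) (simp add: H_def)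
  next
    case (step u v)
    then show ?case
      using H.reachable_adj_trans by simp
  qed
  then obtain p where p: "H.apath y p x"
    using H.reachable_apath by blast
  have "subgraph (with_proj H) (with_proj T)"
    using HT by (intro subgraphI) (auto simp: compatible_def H.wf_digraph T.wf_digraph)
  then have Tp: "T.apath y p x"
    using p T.subgraph_apath_imp_apath by blast
  have "2 \<le> length p"
  proof (rule ccontr)
    assume "\<not> 2 \<le> length p"
    then consider "p = []" | e where "p = [e]"
      by (cases p; cases "tl p") auto
    then show False
    proof cases
      case 1
      then show ?thesis
        using Tp xy(3) T.no_loops' by (auto simp: T.apath_simps)
    next
      case 2
      then have "(y, x) \<in> parcs H"
        using p by (cases e) (auto simp: H.apath_simps)
      then show ?thesis
        using new by (auto simp: H_def)
    qed
  qed
  moreover have "T.cycle ((x, y) # p)"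
    unfolding T.cycle_def
    using Tp xy(3) by (intro exI[of _ x]) (auto simp: T.apath_def T.awalk_simps)
  ultimately show False
    using T unfolding undirected_tree_def by (metis Suc_le_mono length_Cons numeral_2_eq_2 numeral_3_eq_3)
qed

text \<open>
  A largest rooted tree inside \<open>T\<close> with the given apex reaches every vertex, since otherwise
  connectedness provides an arc along which it could be extended; and every arc of \<open>T\<close> is then one of
  its links, since a further arc would close a cycle.
\<close>

lemma ex_represents:
  assumes T: "undirected_tree T" and r: "r \<in> pverts T"
  shows "\<exists>t. apex t = r \<and> represents t T"
proof -
  interpret T: pair_graph T
    using T unfolding undirected_tree_def by blast
  define emb where "emb = (\<lambda>t. apex t = r \<and> distinct (nodes t) \<and> set (nodes t) \<subseteq> pverts T \<and> links t \<subseteq> parcs T)"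
  have "emb (Node r [])"
    using r by (simp add: emb_def)
  moreover have "\<forall>t. emb t \<longrightarrow> length (nodes t) < Suc (card (pverts T))"
    unfolding emb_def by (metis T.pair_finite_verts card_mono distinct_card less_Suc_eq_le)
  ultimately obtain t where t: "emb t" and max: "\<And>s. emb s \<Longrightarrow> length (nodes s) \<le> length (nodes t)"
    using ex_has_greatest_nat[of emb "Node r []" "\<lambda>t. length (nodes t)"] by blast
  have "v \<in> set (nodes t)" if "v \<in> pverts T" for v
  proof -
    have "symmetric (with_proj T)"
      using T.pair_sym_arcs .
    then have "r \<rightarrow>\<^sup>*\<^bsub>with_proj T\<^esub> v"
      using T that r T.symmetric_connected_imp_strongly_connected
      unfolding undirected_tree_def by (auto elim: strongly_connectedE)
    then show ?thesis
    proof (induction rule: T.reachable_induct)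
      case base
      show ?case
        using t apex_in_nodes[of t] by (simp add: emb_def)
    next
      case (step x y)
      have xy: "(x, y) \<in> parcs T"
        using step by simp
      show ?case
      proof (rule ccontr)
        assume y: "y \<notin> set (nodes t)"
        obtain s where s: "apex s = apex t" "mset (nodes s) = add_mset y (mset (nodes t))"
          "links s = insert (x, y) (links t)"
          using ex_attach[OF step.IH, of y] by blast
        have "mset (nodes s) = mset (y # nodes t)"
          using s(2) by simp
        from mset_eq_imp_distinct_iff[OF this] mset_eq_setD[OF this] mset_eq_length[OF this]
        have "distinct (nodes s)" "set (nodes s) = insert y (set (nodes t))"
          "length (nodes s) = Suc (length (nodes t))"
          using t y by (auto simp: emb_def)
        moreover from this have "emb s"
          using t s xy T.in_arcsD2[OF xy] by (auto simp: emb_def)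
        ultimately show False
          using max by fastforce
      qed
    qed
  qed
  then have nodes: "set (nodes t) = pverts T"
    using t by (auto simp: emb_def)
  have "parcs T = links t \<union> (links t)\<inverse>"
  proof
    show "links t \<union> (links t)\<inverse> \<subseteq> parcs T"
      using t T.arcs_symmetric by (auto simp: emb_def)
    show "parcs T \<subseteq> links t \<union> (links t)\<inverse>"
    proof
      fix e assume e: "e \<in> parcs T"
      obtain x y where "e = (x, y)" by force
      then show "e \<in> links t \<union> (links t)\<inverse>"
        using tree_has_no_extra_arc[OF T, of t x y] e t T.in_arcsD1 T.in_arcsD2 nodes
        unfolding emb_def by blast
    qed
  qed
  with t nodes show ?thesis
    unfolding represents_def emb_def by blast
qed

lemma tips_are_leaves:
  assumes "represents t G" "v \<in> set (tips t)" "v \<noteq> apex t"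
  shows "v \<in> leaves G"
proof -
  have d: "distinct (nodes t)" and v: "v \<in> set (nodes t)"
    using assms(1,2) set_tips_subset[of t] unfolding represents_def by auto
  obtain u where u: "(u, v) \<in> links t"
    using ex_parent v assms(3) by metis
  have "e = (v, u)" if "e \<in> links t \<union> (links t)\<inverse>" "fst e = v" for e
  proof (cases e)
    case (Pair a b)
    with that have "a = v" "(b, v) \<in> links t"
      using tip_no_child[OF d assms(2), of b] by auto
    with parent_unique[OF d u] Pair show ?thesis by simp
  qed
  then have "{e \<in> links t \<union> (links t)\<inverse>. fst e = v} = {(v, u)}"
    using u by (intro equalityI subsetI) auto
  then have "out_arcs (with_proj G) v = {(v, u)}"
    using assms(1) unfolding out_arcs_def represents_def by simp
  then show ?thesis
    using v assms(1) unfolding leaves_def out_degree_def represents_def by simp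
qed

lemma represents_at_leaf:
  assumes "represents t G" "apex t \<in> leaves G"
  shows "\<exists>s. t = Node (apex t) [s]"
proof -
  obtain x ts where t: "t = Node x ts"
    by (cases t)
  have d: "distinct (nodes t)"
    using assms(1) unfolding represents_def by blast
  have "card (out_arcs (with_proj G) x) = 1"
    using assms(2) t unfolding leaves_def out_degree_def by simp
  then obtain e where "out_arcs (with_proj G) x = {e}"
    by (auto simp: card_1_singleton_iff)
  then have e: "{e'. e' \<in> links t \<union> (links t)\<inverse> \<and> fst e' = x} = {e}"
    using assms(1) unfolding out_arcs_def represents_def by simp
  have eq: "(x, apex s) = e" if "s \<in> set ts" for s
  proof -
    have "(x, apex s) \<in> {e'. e' \<in> links t \<union> (links t)\<inverse> \<and> fst e' = x}"
      using that by (simp add: t)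
    then show ?thesis
      unfolding e by simp
  qed
  show ?thesis
  proof (cases ts)
    case Nil
    then show ?thesis using e t by simp
  next
    case (Cons a as)
    have "as = []"
    proof (cases as)
      case (Cons b bs)
      then have "apex a = apex b"
        using eq[of a] eq[of b] \<open>ts = a # as\<close> by auto
      then show ?thesis
        using d apex_in_nodes[of a] apex_in_nodes[of b] unfolding t \<open>ts = a # as\<close> Cons by auto
    qed
    with Cons t show ?thesis by simp
  qed
qed

lemma ex_leaf:
  assumes "undirected_tree T" "2 \<le> card (pverts T)"
  shows "\<exists>v. v \<in> leaves T"
proof -
  have "pverts T \<noteq> {}"
    using assms(2) by auto
  then obtain r where r: "r \<in> pverts T"
    by blast
  obtain t where t: "represents t T"
    using ex_represents[OF assms(1) r] by blast
  obtain x ts where Node: "t = Node x ts" by (cases t)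
  have d: "distinct (nodes t)"
    using t unfolding represents_def by blast
  have "length (nodes t) = card (pverts T)"
    using t unfolding represents_def by (metis distinct_card)
  then have "ts \<noteq> []"
    using assms(2) Node by auto
  moreover obtain v where v: "v \<in> set (tips t)"
    using tips_nonempty[of t] by (cases "tips t") auto
  ultimately have "v \<noteq> apex t"
    using d Node set_tips_subset by fastforce
  then show ?thesis
    using tips_are_leaves[OF t v] by blast
qed

section \<open>The costs of isolating a rooted tree\<close>

text \<open>
  The sum of the four costs of the dynamic programme. Here \<open>K\<close> is the sum of the level-0 costs of the
  children. A child of phase 3 needs an extra vertex whenever \<open>x\<close> is not
  selected, so it is no worse to select \<open>x\<close>, and all four costs become \<open>K + 1\<close>. Without such
  children, level 0 costs \<open>K\<close> and level 3 costs at most \<open>K + 1\<close>; a child of phase 0 has its apex selected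
  for free and makes \<open>x\<close> dominated at cost \<open>K\<close> (level 2), while a child of phase 2 lets level 1 cost
  \<open>K + 1\<close> because dominating its apex from below is not free.
\<close>

fun quad_cost :: "'a rtree \<Rightarrow> nat" where
  "quad_cost (Node x ts) =
     (let K = \<Sum>t\<leftarrow>ts. quad_cost t div 4; R = (\<lambda>t. quad_cost t mod 4) ` set ts in
      if 3 \<in> R then 4 * K + 4 else if 0 \<in> R then 4 * K + 1
      else if 2 \<in> R then 4 * K + 3 else 4 * K + 2)"

abbreviation phase :: "'a rtree \<Rightarrow> nat" where
  "phase t \<equiv> quad_cost t mod 4"

text \<open>
  The four levels. The neighbourhood is taken in the ambient graph \<open>G\<close>, so that the links
  of a subtree stay isolated when vertices are selected elsewhere; at level 0 the apex counts as dominated.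
\<close>

definition secures :: "'a pair_pre_digraph \<Rightarrow> nat \<Rightarrow> 'a rtree \<Rightarrow> 'a set \<Rightarrow> bool" where
  "secures G j t D \<longleftrightarrow> D \<subseteq> set (nodes t) \<and>
     (\<forall>(u, v) \<in> links t.
        {u, v} \<inter> (closed_neighbourhood G D \<union> (if j = 0 then {apex t} else {})) \<noteq> {}) \<and>
     (2 \<le> j \<longrightarrow> apex t \<in> closed_neighbourhood G D) \<and> (3 \<le> j \<longrightarrow> apex t \<in> D)"

lemma secures_mono_level:
  "secures G j t D \<Longrightarrow> i \<le> j \<Longrightarrow> secures G i t D"
  unfolding secures_def by (auto split: if_splits; blast)

lemma card_UN_list_le:
  assumes "\<And>t. t \<in> set ts \<Longrightarrow> card (f t) \<le> g t"
  shows "card (\<Union>t\<in>set ts. f t) \<le> (\<Sum>t\<leftarrow>ts. g t)"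
  using assms
proof (induction ts)
  case (Cons t ts)
  have "card (\<Union>t\<in>set (t # ts). f t) \<le> card (f t) + card (\<Union>t\<in>set ts. f t)"
    by (simp add: card_Un_le)
  then show ?case
    using Cons by fastforce
qed simp

lemma closed_neighbourhood_mono: "D \<subseteq> D' \<Longrightarrow> closed_neighbourhood G D \<subseteq> closed_neighbourhood G D'"
  unfolding closed_neighbourhood_def by auto

text \<open>
  Since \<open>(q + j) div 4\<close> exceeds \<open>q div 4\<close> exactly for \<open>j > 3 - q mod 4\<close>, two sets suffice in each case of
  the recursion: the cheaper one for the highest level that costs only \<open>K\<close>, and the children's level-0
  sets together with the apex for all levels above.
\<close>

lemma ex_secures:
  fixes t :: "'a rtree"
  assumes "links t \<subseteq> parcs G" and sym: "\<And>u v. (u, v) \<in> parcs G \<Longrightarrow> (v, u) \<in> parcs G"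
    and "j \<le> 3"
  shows "\<exists>D. secures G j t D \<and> card D \<le> (quad_cost t + j) div 4"
  using assms(1,3)
proof (induction t arbitrary: j)
  case (Node x ts)
  let ?N = "closed_neighbourhood G"
  let ?t = "Node x ts"
  define K where "K = (\<Sum>t\<leftarrow>ts. quad_cost t div 4)"
  have child: "(x, apex t) \<in> parcs G" "(apex t, x) \<in> parcs G" if "t \<in> set ts" for t
    using Node.prems(1) that sym by auto
  \<comment> \<open>A family of levels \<open>h\<close> that each child affords at its base price; the chosen sets are
    united.\<close>
  have combine: "\<exists>f. (\<forall>t\<in>set ts. secures G (h t) t (f t)) \<and> card (\<Union>t\<in>set ts. f t) \<le> K \<and>
      (\<Union>t\<in>set ts. f t) \<subseteq> set (nodes ?t) \<and>
      (\<forall>t\<in>set ts. h t \<noteq> 0 \<longrightarrow> (\<forall>(u, v) \<in> links t. {u, v} \<inter> ?N (\<Union>t\<in>set ts. f t) \<noteq> {})) \<and>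
      (\<forall>t\<in>set ts. 2 \<le> h t \<longrightarrow> apex t \<in> ?N (\<Union>t\<in>set ts. f t)) \<and>
      (\<forall>t\<in>set ts. 3 \<le> h t \<longrightarrow> apex t \<in> (\<Union>t\<in>set ts. f t))"
    if h: "\<And>t. t \<in> set ts \<Longrightarrow> h t \<le> 3 \<and> (quad_cost t + h t) div 4 = quad_cost t div 4" for h
  proof -
    have "\<forall>t\<in>set ts. \<exists>D. secures G (h t) t D \<and> card D \<le> quad_cost t div 4"
    proof
      fix t assume t: "t \<in> set ts"
      then have "links t \<subseteq> parcs G"
        using Node.prems(1) by auto
      from Node.IH[OF t this] h[OF t]
      show "\<exists>D. secures G (h t) t D \<and> card D \<le> quad_cost t div 4" by metis
    qed
    then obtain f where f: "\<forall>t\<in>set ts. secures G (h t) t (f t) \<and> card (f t) \<le> quad_cost t div 4"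
      by metis
    have card: "card (\<Union>t\<in>set ts. f t) \<le> K"
      unfolding K_def using f by (intro card_UN_list_le) auto
    have mono: "?N (f t) \<subseteq> ?N (\<Union>t\<in>set ts. f t)" if "t \<in> set ts" for t
      using that by (intro closed_neighbourhood_mono) auto
    have sub: "(\<Union>t\<in>set ts. f t) \<subseteq> set (nodes ?t)"
      using f unfolding secures_def by fastforce
    have cov: "\<forall>t\<in>set ts. h t \<noteq> 0 \<longrightarrow>
        (\<forall>(u, v) \<in> links t. {u, v} \<inter> ?N (\<Union>t\<in>set ts. f t) \<noteq> {})"
    proof (intro ballI impI, clarify)
      fix t u v assume t: "t \<in> set ts" "0 < h t" and uv: "(u, v) \<in> links t"
        and disj: "{u, v} \<inter> ?N (\<Union>t\<in>set ts. f t) = {}"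
      from f t(1) have "secures G (h t) t (f t)" by blast
      then have "{u, v} \<inter> ?N (f t) \<noteq> {}"
        using uv t(2) unfolding secures_def by auto
      then show False
        using mono[OF t(1)] disj by blast
    qed
    have rt: "\<forall>t\<in>set ts. 2 \<le> h t \<longrightarrow> apex t \<in> ?N (\<Union>t\<in>set ts. f t)"
      using f mono unfolding secures_def by blast
    have "\<forall>t\<in>set ts. 3 \<le> h t \<longrightarrow> apex t \<in> (\<Union>t\<in>set ts. f t)"
      using f unfolding secures_def by blast
    with f card sub cov rt show ?thesis by blast
  qed
  \<comment> \<open>Taking \<open>x\<close> itself dominates all children from above, so level 0 is enough for them.\<close>
  have top: "\<exists>D. secures G 3 ?t D \<and> card D \<le> K + 1"
  proof -
    obtain f where f: "\<forall>t\<in>set ts. secures G 0 t (f t)" "card (\<Union>t\<in>set ts. f t) \<le> K"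
      "(\<Union>t\<in>set ts. f t) \<subseteq> set (nodes ?t)"
      using combine[of "\<lambda>_. 0"] by auto
    define D where "D = insert x (\<Union>t\<in>set ts. f t)"
    have "card D \<le> K + 1"
      unfolding D_def using f(2) card_insert_le_m1[of "K + 1"] by simp
    moreover have x: "x \<in> ?N D" and r: "apex t \<in> ?N D" if "t \<in> set ts" for t
      using child[OF that] unfolding D_def closed_neighbourhood_def by auto
    moreover have "{u, v} \<inter> ?N D \<noteq> {}" if t: "t \<in> set ts" and l: "(u, v) \<in> links t" for u v t
    proof -
      have "{u, v} \<inter> (?N (f t) \<union> {apex t}) \<noteq> {}"
        using f(1) t l unfolding secures_def by auto
      moreover have "?N (f t) \<union> {apex t} \<subseteq> ?N D"
        using r[OF t] closed_neighbourhood_mono[of "f t" D G] t unfolding D_def by auto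
      ultimately show ?thesis by blast
    qed
    moreover have "D \<subseteq> set (nodes ?t)"
      using f(3) unfolding D_def by auto
    moreover have "x \<in> D" "x \<in> ?N D"
      unfolding D_def closed_neighbourhood_def by auto
    ultimately have "secures G 3 ?t D"
      unfolding secures_def by auto
    with \<open>card D \<le> K + 1\<close> show ?thesis by blast
  qed
  \<comment> \<open>Levels above \<open>3 - c\<close> may cost \<open>K + 1\<close> and are served by \<open>top\<close>, so one set of size
    at most \<open>K\<close> at level \<open>3 - c\<close> settles all levels.\<close>
  have finish: ?case if "c \<le> 3" "quad_cost ?t = 4 * K + c"
    "\<exists>D. secures G (3 - c) ?t D \<and> card D \<le> K" for c
  proof (cases "j \<le> 3 - c")
    case True
    then have "(quad_cost ?t + j) div 4 = K"
      using that(1,2) by simp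
    then show ?thesis
      using that(3) True secures_mono_level by metis
  next
    case False
    then have "(quad_cost ?t + j) div 4 = K + 1"
      using that(1,2) \<open>j \<le> 3\<close> by simp
    then show ?thesis
      using top \<open>j \<le> 3\<close> secures_mono_level by metis
  qed
  let ?R = "phase ` set ts"
  have q: "quad_cost ?t = (if 3 \<in> ?R then 4 * K + 4 else if 0 \<in> ?R then 4 * K + 1
      else if 2 \<in> ?R then 4 * K + 3 else 4 * K + 2)"
    by (simp add: Let_def K_def)
  have phase_le: "phase t \<le> 3" for t :: "'a rtree"
    by presburger
  have up: "(quad_cost t + i) div 4 = quad_cost t div 4" if "phase t + i \<le> 3" for t :: "'a rtree" and i
  proof -
    have "quad_cost t + i = (phase t + i) + 4 * (quad_cost t div 4)"
      by simp
    then have "(quad_cost t + i) div 4 = (phase t + i) div 4 + quad_cost t div 4"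
      by (metis div_mult_self2 add.commute zero_neq_numeral)
    then show ?thesis
      using that by simp
  qed
  consider (t0) "3 \<in> ?R" | (t1) "3 \<notin> ?R" "0 \<in> ?R" | (t3) "3 \<notin> ?R" "0 \<notin> ?R" "2 \<in> ?R"
    | (t2) "3 \<notin> ?R" "0 \<notin> ?R" "2 \<notin> ?R"
    by blast
  then show ?case
  proof cases
    case t0
    then have "(quad_cost ?t + j) div 4 = K + 1"
      using q \<open>j \<le> 3\<close> by simp
    then show ?thesis
      using top \<open>j \<le> 3\<close> secures_mono_level by metis
  next
    case t1
    have le: "phase t \<le> 2" if "t \<in> set ts" for t
      using t1(1) phase_le[of t] that by (cases "phase t = 3") force+
    obtain s where s: "s \<in> set ts" "phase s = 0"
      using t1(2) by auto
    \<comment> \<open>The apex of a phase-0 child can be selected at no extra price, and it dominates \<open>x\<close>.\<close>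
    define h where "h = (\<lambda>t. if t = s then 3 else 1 :: nat)"
    have "h t \<le> 3 \<and> (quad_cost t + h t) div 4 = quad_cost t div 4" if "t \<in> set ts" for t
      using le[OF that] s up[of t "h t"] unfolding h_def by auto
    from combine[of h, OF this] obtain f where f: "card (\<Union>t\<in>set ts. f t) \<le> K"
      "(\<Union>t\<in>set ts. f t) \<subseteq> set (nodes ?t)"
      "\<forall>t\<in>set ts. h t \<noteq> 0 \<longrightarrow> (\<forall>(u, v) \<in> links t. {u, v} \<inter> ?N (\<Union>t\<in>set ts. f t) \<noteq> {})"
      "\<forall>t\<in>set ts. 3 \<le> h t \<longrightarrow> apex t \<in> (\<Union>t\<in>set ts. f t)"
      by blast
    have "apex s \<in> (\<Union>t\<in>set ts. f t)"
      using f(4) s(1) by (auto simp: h_def)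
    then have "x \<in> ?N (\<Union>t\<in>set ts. f t)"
      using child(2)[OF s(1)] unfolding closed_neighbourhood_def by blast
    moreover have "\<forall>t\<in>set ts. (\<forall>(u, v) \<in> links t. {u, v} \<inter> ?N (\<Union>t\<in>set ts. f t) \<noteq> {})"
      using f(3) by (simp add: h_def)
    ultimately have "secures G 2 ?t (\<Union>t\<in>set ts. f t)"
      using f(2) unfolding secures_def by auto
    then show ?thesis
      using finish[of 1] f(1) q t1 by auto
  next
    case t3
    have le: "phase t \<le> 2" if "t \<in> set ts" for t
      using t3(1) phase_le[of t] that by (cases "phase t = 3") force+
    have "1 \<le> (3::nat) \<and> (quad_cost t + 1) div 4 = quad_cost t div 4" if "t \<in> set ts" for t
      using le[OF that] up[of t 1] by auto
    from combine[of "\<lambda>_. 1", OF this] obtain f where f: "card (\<Union>t\<in>set ts. f t) \<le> K"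
      "(\<Union>t\<in>set ts. f t) \<subseteq> set (nodes ?t)"
      "\<forall>t\<in>set ts. (\<forall>(u, v) \<in> links t. {u, v} \<inter> ?N (\<Union>t\<in>set ts. f t) \<noteq> {})"
      by auto
    then have "secures G 0 ?t (\<Union>t\<in>set ts. f t)"
      unfolding secures_def by auto
    then show ?thesis
      using finish[of 3] f(1) q t3 by auto
  next
    case t2
    have le: "phase t = 1" if "t \<in> set ts" for t
    proof -
      have "phase t \<noteq> 0" "phase t \<noteq> 2" "phase t \<noteq> 3"
        using t2 that by (metis image_eqI)+
      then show ?thesis by presburger
    qed
    have "2 \<le> (3::nat) \<and> (quad_cost t + 2) div 4 = quad_cost t div 4" if "t \<in> set ts" for t
      using le[OF that] up[of t 2] by auto
    from combine[of "\<lambda>_. 2", OF this] obtain f where f: "card (\<Union>t\<in>set ts. f t) \<le> K"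
      "(\<Union>t\<in>set ts. f t) \<subseteq> set (nodes ?t)"
      "\<forall>t\<in>set ts. (\<forall>(u, v) \<in> links t. {u, v} \<inter> ?N (\<Union>t\<in>set ts. f t) \<noteq> {})"
      "\<forall>t\<in>set ts. apex t \<in> ?N (\<Union>t\<in>set ts. f t)"
      by auto
    then have "secures G 1 ?t (\<Union>t\<in>set ts. f t)"
      unfolding secures_def by auto
    then show ?thesis
      using finish[of 2] f(1) q t2 by auto
  qed
qed

section \<open>Trees of extremal cost\<close>

definition weight :: "'a rtree \<Rightarrow> nat" where
  "weight t = length (nodes t) + length (tips t)"

lemma weight_Node:
  "weight (Node x ts) = 1 + (if ts = [] then 1 else 0) + (\<Sum>t\<leftarrow>ts. weight t)"
proof -
  have "(\<Sum>t\<leftarrow>ts. weight t) = (\<Sum>t\<leftarrow>ts. length (nodes t)) + (\<Sum>t\<leftarrow>ts. length (tips t))"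
    unfolding weight_def by (rule sum_list_addf)
  then show ?thesis
    by (simp add: weight_def length_concat o_def)
qed

text \<open>
  A child of phase \<open>j\<close> contributes \<open>j\<close> beyond four times its level-0 cost; this remainder is what the
  parent's own cost is compared with.
\<close>

lemma quad_cost_children:
  fixes ts :: "'a rtree list"
  defines "c \<equiv> \<lambda>j. length (filter (\<lambda>t. phase t = j) ts)"
  shows "(\<Sum>t\<leftarrow>ts. quad_cost t) = 4 * (\<Sum>t\<leftarrow>ts. quad_cost t div 4) + c 1 + 2 * c 2 + 3 * c 3"
    and "length ts = c 0 + c 1 + c 2 + c 3"
proof -
  have "(\<Sum>t\<leftarrow>ts. quad_cost t) = 4 * (\<Sum>t\<leftarrow>ts. quad_cost t div 4) +
    length (filter (\<lambda>t. phase t = 1) ts) + 2 * length (filter (\<lambda>t. phase t = 2) ts)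
     + 3 * length (filter (\<lambda>t. phase t = 3) ts) \<and>
    length ts = length (filter (\<lambda>t. phase t = 0) ts) + length (filter (\<lambda>t. phase t = 1) ts)
     + length (filter (\<lambda>t. phase t = 2) ts) + length (filter (\<lambda>t. phase t = 3) ts)"
  proof (induction ts)
    case (Cons t ts)
    have "phase t = 0 \<or> phase t = 1 \<or> phase t = 2 \<or> phase t = 3"
      by presburger
    moreover have "quad_cost t = 4 * (quad_cost t div 4) + phase t"
      by simp
    ultimately show ?case
      using Cons by (elim disjE) simp_all
  qed simp
  then show "(\<Sum>t\<leftarrow>ts. quad_cost t) = 4 * (\<Sum>t\<leftarrow>ts. quad_cost t div 4) + c 1 + 2 * c 2 + 3 * c 3"
    and "length ts = c 0 + c 1 + c 2 + c 3"
    unfolding c_def by auto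
qed

text \<open>
  The phases \<open>p\<close> of a node and of its children \<open>ts\<close> for which one step of the recursion attains its
  upper bound.
\<close>

definition locally_tight :: "nat \<Rightarrow> 'a rtree list \<Rightarrow> bool" where
  "locally_tight p ts \<longleftrightarrow>
     p = 0 \<and> (\<exists>us d vs. ts = us @ d # vs \<and> phase d = 3 \<and> (\<forall>t\<in>set (us @ vs). phase t = 0)) \<or>
     p = 1 \<and> ts \<noteq> [] \<and> (\<forall>t\<in>set ts. phase t = 0) \<or>
     p = 2 \<and> (ts = [] \<or> (\<exists>t. ts = [t] \<and> phase t = 1)) \<or>
     p = 3 \<and> (\<exists>t. ts = [t] \<and> phase t = 2)"

text \<open>
  With \<open>c j\<close> children of phase \<open>j\<close>, the slack of the inequality at an inner node is
  \<open>3 * (c 3 - 1) + 2 * c 2 + c 1\<close> if there is a child of phase 3, otherwise \<open>2 * c 2 + c 1\<close> if there is one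
  of phase 0, otherwise \<open>2 * (c 2 - 1) + c 1\<close> if there is one of phase 2, and \<open>c 1 - 1\<close> if all have phase
  1. At a tip both sides are 2.
\<close>

lemma quad_cost_step:
  fixes x :: 'a and ts :: "'a rtree list"
  defines "b \<equiv> 1 + (if ts = [] then 1 else 0) + (\<Sum>t\<leftarrow>ts. quad_cost t)"
  shows "quad_cost (Node x ts) \<le> b"
    and "quad_cost (Node x ts) = b \<Longrightarrow> locally_tight (phase (Node x ts)) ts"
proof -
  define K where "K = (\<Sum>t\<leftarrow>ts. quad_cost t div 4)"
  define c where "c = (\<lambda>j. length (filter (\<lambda>t. phase t = j) ts))"
  have b: "b = 1 + (if ts = [] then 1 else 0) + (4 * K + c 1 + 2 * c 2 + 3 * c 3)"
    unfolding b_def K_def c_def using quad_cost_children(1)[of ts] by simp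
  have len: "length ts = c 0 + c 1 + c 2 + c 3"
    unfolding c_def by (rule quad_cost_children(2))
  have c0: "c j = 0 \<longleftrightarrow> (\<forall>t\<in>set ts. phase t \<noteq> j)" for j
    by (simp add: c_def filter_empty_conv)
  have in_R: "j \<in> (\<lambda>t. phase t) ` set ts \<longleftrightarrow> c j \<noteq> 0" for j
    unfolding c0 by auto
  have q: "quad_cost (Node x ts) = (if c 3 \<noteq> 0 then 4 * K + 4 else if c 0 \<noteq> 0 then 4 * K + 1
      else if c 2 \<noteq> 0 then 4 * K + 3 else 4 * K + 2)"
    by (simp add: Let_def in_R K_def)
  have nil: "ts = [] \<longleftrightarrow> c 0 = 0 \<and> c 1 = 0 \<and> c 2 = 0 \<and> c 3 = 0"
    using len by auto
  show "quad_cost (Node x ts) \<le> b"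
    unfolding q b nil by auto
  assume eq: "quad_cost (Node x ts) = b"
  consider (t0) "c 3 \<noteq> 0" | (t1) "c 3 = 0" "c 0 \<noteq> 0" | (t3) "c 3 = 0" "c 0 = 0" "c 2 \<noteq> 0"
    | (t2) "c 3 = 0" "c 0 = 0" "c 2 = 0"
    by blast
  then show "locally_tight (phase (Node x ts)) ts"
  proof cases
    case t0
    then have k: "c 3 = 1" "c 1 = 0" "c 2 = 0" and p: "phase (Node x ts) = 0"
      using eq unfolding q b nil by auto
    obtain d where "d \<in> set ts" "phase d = 3"
      using t0 c0[of 3] by auto
    then obtain us vs where ts: "ts = us @ d # vs"
      by (meson split_list)
    have "phase t = 0" if "t \<in> set (us @ vs)" for t
    proof -
      have "length (filter (\<lambda>t. phase t = 3) (us @ vs)) = 0"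
        using k(1) \<open>phase d = 3\<close> unfolding c_def ts by simp
      then have "phase t \<noteq> 3"
        using that by (simp add: filter_empty_conv) blast
      moreover have "phase t \<noteq> 1" "phase t \<noteq> 2"
        using k(2,3) that unfolding c0 ts by auto
      ultimately show ?thesis by presburger
    qed
    with ts \<open>phase d = 3\<close> p show ?thesis
      unfolding locally_tight_def by blast
  next
    case t1
    then have k: "c 1 = 0" "c 2 = 0" and p: "phase (Node x ts) = 1"
      using eq unfolding q b nil by (auto simp: mod_Suc)
    have "phase t = 0" if "t \<in> set ts" for t
    proof -
      have "phase t \<noteq> 1" "phase t \<noteq> 2" "phase t \<noteq> 3"
        using k t1 that unfolding c0 by auto
      then show ?thesis by presburger
    qed
    with p t1 nil show ?thesis
      unfolding locally_tight_def by blast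
  next
    case t3
    then have k: "c 1 = 0" "c 2 = 1" and p: "phase (Node x ts) = 3"
      using eq unfolding q b nil by (auto simp: mod_Suc)
    then have "length ts = 1"
      using len t3 by simp
    then obtain t where ts: "ts = [t]"
      by (auto simp: length_Suc_conv)
    with k have "phase t = 2"
      unfolding c_def by (auto split: if_splits)
    with p ts show ?thesis
      unfolding locally_tight_def by blast
  next
    case t2
    then have p: "phase (Node x ts) = 2"
      using eq unfolding q b nil by (auto simp: mod_Suc)
    have k: "c 1 \<le> 1"
      using eq t2 unfolding q b nil by (auto split: if_splits)
    show ?thesis
    proof (cases "ts = []")
      case False
      then have "length ts = 1" "c 1 = 1"
        using len t2 k by (auto simp: le_Suc_eq)
      then obtain t where ts: "ts = [t]"
        by (auto simp: length_Suc_conv)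
      with \<open>c 1 = 1\<close> have "phase t = 1"
        unfolding c_def by (auto split: if_splits)
      with p ts show ?thesis
        unfolding locally_tight_def by blast
    qed (simp add: p locally_tight_def)
  qed
qed

lemma quad_cost_le_weight: "quad_cost t \<le> weight t"
proof (induction t)
  case (Node x ts)
  then have "(\<Sum>t\<leftarrow>ts. quad_cost t) \<le> (\<Sum>t\<leftarrow>ts. weight t)"
    by (intro sum_list_mono) auto
  then show ?case
    using quad_cost_step(1)[of x ts] unfolding weight_Node by linarith
qed

definition tight :: "'a rtree \<Rightarrow> bool" where
  "tight t \<longleftrightarrow> quad_cost t = weight t"

lemma sum_list_mono_tight:
  fixes f g :: "'b \<Rightarrow> nat"
  assumes "\<And>t. t \<in> set ts \<Longrightarrow> f t \<le> g t" and "(\<Sum>t\<leftarrow>ts. g t) \<le> (\<Sum>t\<leftarrow>ts. f t)"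
    and "t \<in> set ts"
  shows "f t = g t"
  using assms
proof (induction ts)
  case (Cons a ts)
  have "(\<Sum>t\<leftarrow>ts. f t) \<le> (\<Sum>t\<leftarrow>ts. g t)"
    using Cons.prems(1) by (intro sum_list_mono) auto
  then show ?case
    using Cons.prems Cons.IH by (fastforce simp: le_antisym)
qed simp

lemma tight_Node:
  assumes "tight (Node x ts)"
  shows "t \<in> set ts \<Longrightarrow> tight t" and "phase (Node x ts) = p \<Longrightarrow> locally_tight p ts"
proof -
  have le: "(\<Sum>t\<leftarrow>ts. quad_cost t) \<le> (\<Sum>t\<leftarrow>ts. weight t)"
    by (intro sum_list_mono quad_cost_le_weight)
  note step = quad_cost_step[of x ts]
  have w: "quad_cost (Node x ts) = 1 + (if ts = [] then 1 else 0) + (\<Sum>t\<leftarrow>ts. weight t)"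
    using assms unfolding tight_def weight_Node .
  then have eq: "(\<Sum>t\<leftarrow>ts. weight t) \<le> (\<Sum>t\<leftarrow>ts. quad_cost t)"
    using step(1) by linarith
  show "tight t" if "t \<in> set ts"
    unfolding tight_def using sum_list_mono_tight[OF quad_cost_le_weight eq that] .
  have "locally_tight (phase (Node x ts)) ts"
    using step(2) w le eq by linarith
  then show "locally_tight p ts" if "phase (Node x ts) = p"
    unfolding that .
qed

lemma tight_phase_1:
  assumes "tight (Node x ts)" "phase (Node x ts) = 1"
  shows "ts \<noteq> [] \<and> (\<forall>t\<in>set ts. tight t \<and> phase t = 0)"
proof -
  have "ts \<noteq> []" and *: "\<forall>t\<in>set ts. phase t = 0"
    using tight_Node(2)[OF assms] unfolding locally_tight_def by simp_all
  moreover have "tight t \<and> phase t = 0" if "t \<in> set ts" for t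
    using tight_Node(1)[OF assms(1) that] bspec[OF * that] ..
  ultimately show ?thesis by simp
qed

lemma tight_phase_2:
  assumes "tight (Node x ts)" "phase (Node x ts) = 2"
  shows "ts = [] \<or> (\<exists>w us. ts = [Node w us] \<and> us \<noteq> [] \<and> (\<forall>t\<in>set us. tight t \<and> phase t = 0))"
proof (cases "ts = []")
  case False
  then obtain t where t: "ts = [t]" "phase t = 1"
    using tight_Node(2)[OF assms] unfolding locally_tight_def by auto
  obtain w us where w: "t = Node w us" by (cases t)
  have "tight t"
    by (rule tight_Node(1)[OF assms(1)]) (simp add: t(1))
  from tight_phase_1[OF this[unfolded w] t(2)[unfolded w]] show ?thesis
    unfolding t(1) w by blast
qed simp

lemma tight_phase_3:
  assumes "tight t" "phase t = 3"
  shows "\<exists>y z ts. t = Node y [Node z ts] \<and> tight (Node z ts) \<and> phase (Node z ts) = 2"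
proof -
  obtain y ss where Node: "t = Node y ss" by (cases t)
  obtain s where s: "ss = [s]" "phase s = 2"
    using tight_Node(2)[OF assms[unfolded Node]] unfolding locally_tight_def by auto
  have "tight s"
    by (rule tight_Node(1)[OF assms(1)[unfolded Node]]) (simp add: s(1))
  moreover obtain z ts where "s = Node z ts" by (cases s)
  ultimately show ?thesis
    using s(2) unfolding Node s(1) by blast
qed

lemma tight_phase_0:
  assumes "tight t" "phase t = 0"
  shows "\<exists>x us vs y z ts. t = Node x (us @ Node y [Node z ts] # vs) \<and>
    (\<forall>s\<in>set (us @ vs). tight s \<and> phase s = 0) \<and>
    (ts = [] \<or> (\<exists>w ws. ts = [Node w ws] \<and> ws \<noteq> [] \<and> (\<forall>s\<in>set ws. tight s \<and> phase s = 0)))"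
proof -
  obtain x ss where Node: "t = Node x ss" by (cases t)
  obtain us d vs where ss: "ss = us @ d # vs" "phase d = 3" "\<forall>t\<in>set (us @ vs). phase t = 0"
    using tight_Node(2)[OF assms[unfolded Node]] unfolding locally_tight_def by auto
  have ti: "tight s" if "s \<in> set ss" for s
    using tight_Node(1)[OF assms(1)[unfolded Node] that] .
  have "tight d"
    using ti ss(1) by simp
  from tight_phase_3[OF this ss(2)]
  obtain y z ts where d: "d = Node y [Node z ts]" "tight (Node z ts)" "phase (Node z ts) = 2"
    by blast
  from tight_phase_2[OF d(2,3)]
  have "ts = [] \<or> (\<exists>w ws. ts = [Node w ws] \<and> ws \<noteq> [] \<and> (\<forall>s\<in>set ws. tight s \<and> phase s = 0))" .
  moreover have "\<forall>s\<in>set (us @ vs). tight s \<and> phase s = 0"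
    using ti ss by auto
  ultimately show ?thesis
    using Node ss(1) d(1) by blast
qed

text \<open>
  The cost at a leaf root above \<open>s\<close>, for a bound \<open>w\<close> on the cost of \<open>s\<close> and \<open>m = n + l\<close>. The root raises
  four times the level-1 cost above \<open>quad_cost s\<close> by 0, -1, 2 and 1 for \<open>s\<close> of phase 0, 1, 2 and 3,
  whereas \<open>m\<close> exceeds \<open>w\<close> by at least 2; so only phase 2 leaves room, and none to spare.
\<close>

lemma cost_over_leaf_root:
  assumes "m \<le> 4 * ((quad_cost (Node x [s]) + 1) div 4)" "w + 2 \<le> m" "quad_cost s \<le> w"
  shows "phase s = 2 \<and> w = quad_cost s \<and> m = w + 2"
proof -
  define k p where "k = quad_cost s div 4" and "p = phase s"
  have cost: "quad_cost (Node x [s]) =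
      4 * k + (if p = 3 then 4 else if p = 0 then 1 else if p = 2 then 3 else 2)"
    unfolding k_def p_def by simp
  have s: "quad_cost s = 4 * k + p" and "p < 4"
    unfolding k_def p_def by simp_all
  have "p = 2 \<and> w = 4 * k + p \<and> m = w + 2"
  proof -
    consider "p = 0" | "p = 1" | "p = 2" | "p = 3"
      using \<open>p < 4\<close> by linarith
    then show ?thesis
      using assms unfolding cost s by cases (simp; presburger)+
  qed
  then show ?thesis
    unfolding s[symmetric] unfolding p_def .
qed

section \<open>Splitting a tight forest into paths of order 3 and 4\<close>

type_synonym 'a triples = "('a \<times> 'a \<times> 'a) list"

type_synonym 'a quads = "('a \<times> 'a \<times> 'a \<times> 'a) list"

definition cells :: "'a triples \<Rightarrow> 'a quads \<Rightarrow> 'a set" where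
  "cells P Q = (\<Union>(a, b, c)\<in>set P. {a, b, c}) \<union> (\<Union>(x, y, y', x')\<in>set Q. {x, y, y', x'})"

definition path_links :: "'a triples \<Rightarrow> 'a quads \<Rightarrow> ('a \<times> 'a) set" where
  "path_links P Q = (\<Union>(a, b, c)\<in>set P. {(a, b), (b, c)}) \<union>
     (\<Union>(x, y, y', x')\<in>set Q. {(x, y), (y, y'), (y', x')})"

definition ends :: "'a triples \<Rightarrow> 'a quads \<Rightarrow> 'a set" where
  "ends P Q = (\<Union>(a, b, c)\<in>set P. {a}) \<union> (\<Union>(x, y, y', x')\<in>set Q. {x, x'})"

lemma Cons_triple:
  "cells ((a, b, c) # P) Q = {a, b, c} \<union> cells P Q"
  "path_links ((a, b, c) # P) Q = {(a, b), (b, c)} \<union> path_links P Q"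
  "ends ((a, b, c) # P) Q = insert a (ends P Q)"
  by (auto simp: cells_def path_links_def ends_def)

lemma Cons_quad:
  "cells P ((x, y, y', x') # Q) = {x, y, y', x'} \<union> cells P Q"
  "path_links P ((x, y, y', x') # Q) = {(x, y), (y, y'), (y', x')} \<union> path_links P Q"
  "ends P ((x, y, y', x') # Q) = {x, x'} \<union> ends P Q"
  by (auto simp: cells_def path_links_def ends_def)

definition forest_links :: "'a rtree list \<Rightarrow> ('a \<times> 'a) set" where
  "forest_links ts = (\<Union>t\<in>set ts. links t)"

text \<open>
  The lists \<open>P\<close> and \<open>Q\<close> of paths partition the nodes of the forest \<open>ts\<close>: if its nodes are distinct,
  the paths are vertex-disjoint because they cover the nodes while the lengths add up. All apices are
  endpoints, so that the forest may be hung below another endpoint. Every endpoint has a child, and a nonempty forest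
  contains a path of order 3; these two properties later show that endpoints are not leaves and that
  there are at least two paths of order 3.
\<close>

definition decomposes :: "'a rtree list \<Rightarrow> 'a triples \<Rightarrow> 'a quads \<Rightarrow> bool" where
  "decomposes ts P Q \<longleftrightarrow>
     (\<Union>t\<in>set ts. set (nodes t)) = cells P Q \<and>
     (\<Sum>t\<leftarrow>ts. length (nodes t)) = 3 * length P + 4 * length Q \<and>
     apex ` set ts \<subseteq> ends P Q \<and>
     path_links P Q \<subseteq> forest_links ts \<and>
     forest_links ts \<subseteq> path_links P Q \<union> ends P Q \<times> ends P Q \<and>
     (\<forall>v\<in>ends P Q. \<exists>c. (v, c) \<in> forest_links ts) \<and>
     (ts \<noteq> [] \<longrightarrow> P \<noteq> [])"

lemma decomposes_triple:
  assumes "decomposes (us @ vs @ ts) P Q"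
  shows "decomposes (Node x (us @ Node y [Node z []] # vs) # ts) ((x, y, z) # P) Q"
proof -
  let ?ts = "us @ vs @ ts" and ?ts' = "Node x (us @ Node y [Node z []] # vs) # ts"
  have links: "forest_links ?ts' =
      {(x, y), (y, z)} \<union> Pair x ` apex ` set (us @ vs) \<union> forest_links ?ts"
    by (auto simp: forest_links_def)
  note d = assms[unfolded decomposes_def]
  show ?thesis
    unfolding decomposes_def
  proof (intro conjI ballI impI)
    show "(\<Union>t\<in>set ?ts'. set (nodes t)) = cells ((x, y, z) # P) Q"
      using d unfolding Cons_triple by auto
    show "(\<Sum>t\<leftarrow>?ts'. length (nodes t)) = 3 * length ((x, y, z) # P) + 4 * length Q"
      using d by (simp add: length_concat o_def)
    show "apex ` set ?ts' \<subseteq> ends ((x, y, z) # P) Q"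
      using d unfolding Cons_triple by auto
    show "path_links ((x, y, z) # P) Q \<subseteq> forest_links ?ts'"
      using d unfolding links Cons_triple by blast
    show "forest_links ?ts'
        \<subseteq> path_links ((x, y, z) # P) Q \<union> ends ((x, y, z) # P) Q \<times> ends ((x, y, z) # P) Q"
    proof -
      have "forest_links ?ts \<subseteq> path_links P Q \<union> ends P Q \<times> ends P Q"
        using d by (elim conjE)
      moreover have "apex ` set (us @ vs) \<subseteq> ends P Q"
        using d by auto
      ultimately show ?thesis
        unfolding links Cons_triple by blast
    qed
    show "\<exists>c. (v, c) \<in> forest_links ?ts'" if "v \<in> ends ((x, y, z) # P) Q" for v
    proof -
      have "\<forall>v\<in>ends P Q. \<exists>c. (v, c) \<in> forest_links ?ts"
        using d by (elim conjE)
      moreover have "(x, y) \<in> forest_links ?ts'"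
        unfolding links by simp
      moreover have "forest_links ?ts \<subseteq> forest_links ?ts'"
        unfolding links by (rule Un_upper2)
      moreover have "v = x \<or> v \<in> ends P Q"
        using that unfolding Cons_triple by simp
      ultimately show ?thesis
        by (metis subsetD)
    qed
    show "(x, y, z) # P \<noteq> []"
      by simp
  qed
qed

lemma decomposes_quad:
  assumes "decomposes (us @ vs @ ws @ ts) P Q" "ws \<noteq> []"
  shows "decomposes (Node x (us @ Node y [Node y' [Node x' ws]] # vs) # ts) P ((x, y, y', x') # Q)"
proof -
  let ?ts = "us @ vs @ ws @ ts" and ?ts' = "Node x (us @ Node y [Node y' [Node x' ws]] # vs) # ts"
  have links: "forest_links ?ts' = {(x, y), (y, y'), (y', x')} \<union>
      Pair x ` apex ` set (us @ vs) \<union> Pair x' ` apex ` set ws \<union> forest_links ?ts"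
    by (auto simp: forest_links_def)
  note d = assms(1)[unfolded decomposes_def]
  show ?thesis
    unfolding decomposes_def
  proof (intro conjI ballI impI)
    show "(\<Union>t\<in>set ?ts'. set (nodes t)) = cells P ((x, y, y', x') # Q)"
      using d unfolding Cons_quad by auto
    show "(\<Sum>t\<leftarrow>?ts'. length (nodes t)) = 3 * length P + 4 * length ((x, y, y', x') # Q)"
      using d by (simp add: length_concat o_def)
    show "apex ` set ?ts' \<subseteq> ends P ((x, y, y', x') # Q)"
      using d unfolding Cons_quad by auto
    show "path_links P ((x, y, y', x') # Q) \<subseteq> forest_links ?ts'"
      using d unfolding links Cons_quad by blast
    show "forest_links ?ts' \<subseteq>
        path_links P ((x, y, y', x') # Q) \<union> ends P ((x, y, y', x') # Q) \<times> ends P ((x, y, y', x') # Q)"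
    proof -
      have "forest_links ?ts \<subseteq> path_links P Q \<union> ends P Q \<times> ends P Q"
        using d by (elim conjE)
      moreover have "apex ` set (us @ vs) \<subseteq> ends P Q" "apex ` set ws \<subseteq> ends P Q"
        using d by auto
      ultimately show ?thesis
        unfolding links Cons_quad by blast
    qed
    have "hd ws \<in> set ws"
      using assms(2) by simp
    show "\<exists>c. (v, c) \<in> forest_links ?ts'" if "v \<in> ends P ((x, y, y', x') # Q)" for v
    proof -
      have "\<forall>v\<in>ends P Q. \<exists>c. (v, c) \<in> forest_links ?ts"
        using d by (elim conjE)
      moreover have "(x, y) \<in> forest_links ?ts'"
        unfolding links by simp
      moreover have "(x', apex (hd ws)) \<in> forest_links ?ts'"
        unfolding links using \<open>hd ws \<in> set ws\<close> by simp
      moreover have "forest_links ?ts \<subseteq> forest_links ?ts'"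
        unfolding links by (rule Un_upper2)
      moreover have "v = x \<or> v = x' \<or> v \<in> ends P Q"
        using that unfolding Cons_quad by simp
      ultimately show ?thesis
        by (metis subsetD)
    qed
    show "P \<noteq> []"
      using d assms(2) by simp
  qed
qed

text \<open>
  The path that starts at the apex of the first tree is split off; what remains of this tree is again
  a forest of tight trees of phase 0, to be decomposed together with the other trees.
\<close>

lemma ex_decomposes:
  assumes "\<forall>t\<in>set ts. tight t \<and> phase t = 0"
  shows "\<exists>P Q. decomposes ts P Q"
  using assms
proof (induction "\<Sum>t\<leftarrow>ts. length (nodes t)" arbitrary: ts rule: less_induct)
  case less
  show ?case
  proof (cases ts)
    case Nil
    then show ?thesis
      by (intro exI[of _ "[]"]) (simp add: decomposes_def cells_def path_links_def ends_def forest_links_def)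
  next
    case (Cons t rest)
    have "tight t" "phase t = 0"
      using bspec[OF less.prems, of t] unfolding Cons by simp_all
    from tight_phase_0[OF this] obtain x us vs y z gs where t: "t = Node x (us @ Node y [Node z gs] # vs)"
      "\<forall>s\<in>set (us @ vs). tight s \<and> phase s = 0"
      and gs: "gs = [] \<or> (\<exists>w ws. gs = [Node w ws] \<and> ws \<noteq> [] \<and> (\<forall>s\<in>set ws. tight s \<and> phase s = 0))"
      by (elim exE conjE) (rule that)
    from gs show ?thesis
    proof (elim disjE exE conjE)
      assume g: "gs = []"
      have "(\<Sum>t\<leftarrow>us @ vs @ rest. length (nodes t)) < (\<Sum>t\<leftarrow>ts. length (nodes t))"
        unfolding Cons t(1) by (simp add: length_concat o_def)
      moreover have "\<forall>t\<in>set (us @ vs @ rest). tight t \<and> phase t = 0"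
        using t(2) less.prems Cons by auto
      ultimately obtain P Q where "decomposes (us @ vs @ rest) P Q"
        using less.hyps by blast
      from decomposes_triple[OF this] show ?thesis
        unfolding Cons t(1) g by blast
    next
      fix w ws assume g: "gs = [Node w ws]" "ws \<noteq> []" "\<forall>s\<in>set ws. tight s \<and> phase s = 0"
      have "(\<Sum>t\<leftarrow>us @ vs @ ws @ rest. length (nodes t)) < (\<Sum>t\<leftarrow>ts. length (nodes t))"
        unfolding Cons t(1) g(1) by (simp add: length_concat o_def)
      moreover have "\<forall>t\<in>set (us @ vs @ ws @ rest). tight t \<and> phase t = 0"
        using t(2) less.prems Cons g(3) by auto
      ultimately obtain P Q where "decomposes (us @ vs @ ws @ rest) P Q"
        using less.hyps by blast
      from decomposes_quad[OF this g(2)] show ?thesis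
        unfolding Cons t(1) g(1) by blast
    qed
  qed
qed

section \<open>Recognising members of the family\<close>

fun place :: "'a triples \<Rightarrow> 'a quads \<Rightarrow> copy_vertex \<Rightarrow> 'a" where
  "place P Q (VA i) = fst (P ! i)"
| "place P Q (VB i) = fst (snd (P ! i))"
| "place P Q (VC i) = snd (snd (P ! i))"
| "place P Q (VX j b) = (if b then snd (snd (snd (Q ! j))) else fst (Q ! j))"
| "place P Q (VY j b) = (if b then fst (snd (snd (Q ! j))) else fst (snd (Q ! j)))"

lemma set_eq_image_nth: "set xs = (\<lambda>i. xs ! i) ` {..<length xs}"
  by (auto simp: set_conv_nth)

lemma place_image:
  "place P Q ` copies_vertices (length P) (length Q) = cells P Q"
  "place P Q ` attachment_vertices (length P) (length Q) = ends P Q"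
  "map_prod (place P Q) (place P Q) ` copies_arcs (length P) (length Q) = path_links P Q"
  unfolding copies_vertices_def attachment_vertices_def copies_arcs_def cells_def ends_def path_links_def
  by (simp_all add: set_eq_image_nth image_Un image_UN case_prod_beta insert_commute)

lemma card_copies_vertices_le: "card (copies_vertices r s) \<le> 3 * r + 4 * s"
proof -
  have "card (\<Union>i<r. {VA i, VB i, VC i}) \<le> (\<Sum>i<r. card {VA i, VB i, VC i})"
    by (rule card_UN_le) simp
  moreover have "card (\<Union>j<s. {VX j False, VY j False, VY j True, VX j True})
      \<le> (\<Sum>j<s. card {VX j False, VY j False, VY j True, VX j True})"
    by (rule card_UN_le) simp
  ultimately have "card (\<Union>i<r. {VA i, VB i, VC i}) +
      card (\<Union>j<s. {VX j False, VY j False, VY j True, VX j True}) \<le> 3 * r + 4 * s"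
    by simp
  then show ?thesis
    unfolding copies_vertices_def using card_Un_le order_trans by blast
qed

lemma parcs_mk_symmetric_pair: "parcs (mk_symmetric (with_proj G)) = parcs G \<union> (parcs G)\<inverse>"
proof -
  have "parcs (mk_symmetric (with_proj G)) = (\<Union>(u, v)\<in>parcs G. {(u, v), (v, u)})"
    by (auto simp: parcs_mk_symmetric case_prod_beta)
  also have "\<dots> = parcs G \<union> (parcs G)\<inverse>"
    by auto
  finally show ?thesis .
qed

text \<open>
  The map \<open>place P Q\<close> sends the \<open>i\<close>-th abstract copy to the \<open>i\<close>-th path. It is onto, and it is injective
  because the numbers of vertices agree; hence it is an isomorphism once the arcs between endpoints are
  pulled back to \<open>E\<close>.
\<close>

lemma in_family_F:
  assumes T: "undirected_tree T"
    and cells: "pverts T = cells P Q" and card: "card (pverts T) = 3 * length P + 4 * length Q"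
    and arcs: "path_links P Q \<subseteq> parcs T"
      "parcs T \<subseteq> path_links P Q \<union> (path_links P Q)\<inverse> \<union> ends P Q \<times> ends P Q"
    and P: "2 \<le> length P" and leaves: "ends P Q \<inter> leaves T = {}"
  shows "T \<in> family_F"
proof -
  interpret T: pair_graph T
    using T unfolding undirected_tree_def by blast
  define r s where "r = length P" and "s = length Q"
  define f where "f = place P Q"
  let ?A = "attachment_vertices r s"
  define E where "E = {(p, q) \<in> ?A \<times> ?A. (f p, f q) \<in> parcs T}"
  define J where "J = join_copies r s E"
  have verts_J: "pverts J = copies_vertices r s"
    unfolding J_def join_copies_def by simp
  have arcs_J: "parcs J = (copies_arcs r s \<union> E) \<union> (copies_arcs r s \<union> E)\<inverse>"
    unfolding J_def join_copies_def parcs_mk_symmetric_pair by simp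
  have A_verts: "?A \<subseteq> copies_vertices r s"
    unfolding attachment_vertices_def copies_vertices_def by auto
  have "copies_arcs r s \<union> E \<subseteq> copies_vertices r s \<times> copies_vertices r s"
    using A_verts unfolding copies_arcs_def E_def by (auto simp: copies_vertices_def)
  then interpret J: pair_wf_digraph J
    unfolding arcs_J verts_J by unfold_locales (auto simp: arcs_J verts_J)
  have f_verts: "f ` copies_vertices r s = pverts T"
    and f_A: "f ` ?A = ends P Q"
    and f_arcs: "map_prod f f ` copies_arcs r s = path_links P Q"
    unfolding f_def r_def s_def cells by (fact place_image)+
  have fin: "finite (copies_vertices r s)"
    unfolding copies_vertices_def by simp
  have "card (f ` copies_vertices r s) = card (pverts T)"
    by (simp only: f_verts)
  then have "card (f ` copies_vertices r s) = card (copies_vertices r s)"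
    using card_copies_vertices_le[of r s] card_image_le[OF fin, of f] card
    unfolding r_def s_def by linarith
  then have inj: "inj_on f (copies_vertices r s)"
    using fin by (simp add: eq_card_imp_inj_on)
  have f_E: "map_prod f f ` E = parcs T \<inter> ends P Q \<times> ends P Q"
    unfolding E_def f_A[symmetric] by auto
  have "map_prod f f ` parcs J = (map_prod f f ` (copies_arcs r s \<union> E)) \<union> (map_prod f f ` (copies_arcs r s \<union> E))\<inverse>"
    unfolding arcs_J by force
  also have "\<dots> = parcs T"
    unfolding image_Un f_arcs f_E using arcs T.arcs_symmetric by blast
  finally have f_parcs: "map_prod f f ` parcs J = parcs T" .
  define h where "h = \<lparr>iso_verts = f, iso_arcs = map_prod f f, iso_head = snd, iso_tail = fst\<rparr>"
  have "parcs J \<subseteq> pverts J \<times> pverts J"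
    using J.arc_fst_in_verts J.arc_snd_in_verts by force
  moreover have "inj_on (map_prod f f) (pverts J \<times> pverts J)"
    using inj verts_J by (simp add: map_prod_inj_on)
  ultimately have "inj_on (map_prod f f) (parcs J)"
    using inj_on_subset by blast
  then have iso: "J.digraph_isomorphism h"
    using inj verts_J J.wf_digraph unfolding J.digraph_isomorphism_def by (simp add: h_def)
  have app: "with_proj T = app_iso h (with_proj J)"
    unfolding app_iso_def h_def with_proj_def using f_parcs f_verts verts_J by simp
  then have "digraph_iso (with_proj J) (with_proj T)"
    using iso unfolding digraph_iso_def by blast
  moreover have "?A \<inter> leaves J = {}"
  proof (rule ccontr)
    assume "?A \<inter> leaves J \<noteq> {}"
    then obtain v where v: "v \<in> ?A" "v \<in> leaves J"
      by blast
    then have "f v \<in> ends P Q" "f v \<in> pverts T"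
      using f_A f_verts A_verts by auto
    moreover have "out_degree (with_proj T) (f v) = 1"
      using J.out_degree_app_iso_eq[OF iso, of v] v(2) unfolding app leaves_def
      by (simp add: h_def)
    ultimately show False
      using leaves unfolding leaves_def by blast
  qed
  moreover have "E \<subseteq> ?A \<times> ?A"
    unfolding E_def by blast
  ultimately show ?thesis
    using T P unfolding family_F_def J_def r_def by blast
qed

section \<open>Extremal trees\<close>

lemma isolation_number_le:
  assumes "isolating_set G D"
  shows "isolation_number G \<le> card D"
  unfolding isolation_number_def using assms by (intro Least_le) blast

lemma secures_imp_isolating_set:
  assumes "represents t G" "secures G 1 t D"
  shows "isolating_set G D"
proof -
  let ?N = "closed_neighbourhood G D"
  have "{u, v} \<inter> ?N \<noteq> {}" if "(u, v) \<in> parcs G" for u v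
    using that assms unfolding represents_def secures_def by auto
  then have "arcs (with_proj G \<restriction> (pverts G - ?N)) = {}"
    by (fastforce simp: induce_subgraph_def)
  then show ?thesis
    using assms unfolding isolating_set_def represents_def secures_def by simp
qed

theorem theorem3p9:
  fixes T :: "'a pair_pre_digraph" and n l :: nat
  assumes "undirected_tree T"
    and "card (pverts T) = n"
    and "n \<ge> 6"
    and "card (leaves T) = l"
    and "real (isolation_number T) = (real n + real l) / 4"
  shows "T \<in> family_F"
proof -
  interpret T: pair_graph T
    using assms(1) unfolding undirected_tree_def by blast
  obtain \<rho> where \<rho>: "\<rho> \<in> leaves T"
    using ex_leaf[OF assms(1)] assms(2,3) by auto
  then obtain t where t: "apex t = \<rho>" "represents t T"
    using ex_represents[OF assms(1)] unfolding leaves_def by blast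
  then obtain s where ts: "t = Node \<rho> [s]"
    using represents_at_leaf \<rho> by blast
  have d: "distinct (nodes t)" and verts: "set (nodes t) = pverts T"
    and arcs: "parcs T = links t \<union> (links t)\<inverse>"
    using t(2) unfolding represents_def by auto
  have n: "n = 1 + length (nodes s)"
    using distinct_card[OF d] verts assms(2) by (simp add: ts)
  have tips: "insert \<rho> (set (tips s)) \<subseteq> leaves T"
  proof -
    have "v \<in> leaves T" if "v \<in> set (tips s)" for v
    proof (rule tips_are_leaves[OF t(2)])
      show "v \<in> set (tips t)"
        using that by (simp add: ts)
      show "v \<noteq> apex t"
        using that d set_tips_subset[of s] by (auto simp: ts)
    qed
    then show ?thesis
      using \<rho> by blast
  qed
  have fin: "finite (leaves T)"
    unfolding leaves_def using T.pair_finite_verts by simp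
  have card_tips: "card (insert \<rho> (set (tips s))) = 1 + length (tips s)"
  proof -
    have "\<rho> \<notin> set (tips s)"
      using d set_tips_subset[of s] by (auto simp: ts)
    moreover have "distinct (tips s)"
      using d by (intro distinct_tips) (simp add: ts)
    ultimately show ?thesis
      by (simp add: distinct_card)
  qed
  then have l: "1 + length (tips s) \<le> l"
    using card_mono[OF fin tips] assms(4) by simp
  have "\<exists>D. secures T 1 t D \<and> card D \<le> (quad_cost t + 1) div 4"
    using arcs T.arcs_symmetric by (intro ex_secures) auto
  then have iota: "isolation_number T \<le> (quad_cost t + 1) div 4"
    using secures_imp_isolating_set[OF t(2)] isolation_number_le order_trans by blast
  have "4 * isolation_number T = n + l"
    using assms(5) by (simp add: field_simps flip: of_nat_add of_nat_mult)
  with iota have "n + l \<le> 4 * ((quad_cost t + 1) div 4)"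
    by linarith
  moreover have "weight s + 2 \<le> n + l"
    unfolding weight_def n using l by simp
  moreover have "quad_cost s \<le> weight s"
    by (rule quad_cost_le_weight)
  ultimately have "phase s = 2 \<and> weight s = quad_cost s \<and> n + l = weight s + 2"
    unfolding ts by (rule cost_over_leaf_root)
  then have s: "tight s" "phase s = 2" and l': "l = 1 + length (tips s)"
    unfolding tight_def weight_def n by auto
  have leaves: "leaves T = insert \<rho> (set (tips s))"
    using card_subset_eq[OF fin tips] card_tips assms(4) l' by simp
  obtain u ws where u: "s = Node u ws"
    by (cases s)
  have "ws \<noteq> []"
    using n assms(3) u by auto
  with tight_phase_2[OF s[unfolded u]]
  obtain w us where ws: "ws = [Node w us]" "us \<noteq> []" "\<forall>t\<in>set us. tight t \<and> phase t = 0"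
    by (elim disjE exE conjE) simp_all
  obtain P Q where dec: "decomposes us P Q"
    using ex_decomposes ws(3) by blast
  let ?P = "(w, u, \<rho>) # P"
  let ?L = "forest_links us"
  have t_eq: "t = Node \<rho> [Node u [Node w us]]"
    using ts u ws by simp
  have links: "links t = {(\<rho>, u), (u, w)} \<union> (\<lambda>t. (w, apex t)) ` set us \<union> ?L"
    unfolding t_eq forest_links_def by auto
  show ?thesis
  proof (rule in_family_F[OF assms(1), of ?P Q])
    show "pverts T = cells ?P Q"
      using dec unfolding verts[symmetric] t_eq Cons_triple decomposes_def by auto
    have "length (nodes t) = 3 * length ?P + 4 * length Q"
      using dec unfolding t_eq decomposes_def by (simp add: length_concat o_def)
    then show "card (pverts T) = 3 * length ?P + 4 * length Q"
      using distinct_card[OF d] verts by simp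
    show "path_links ?P Q \<subseteq> parcs T"
      using dec unfolding arcs links Cons_triple decomposes_def by auto
    have "(\<lambda>t. (w, apex t)) ` set us \<subseteq> ends ?P Q \<times> ends ?P Q"
      using dec unfolding Cons_triple decomposes_def by auto
    moreover have "?L \<subseteq> path_links ?P Q \<union> ends ?P Q \<times> ends ?P Q"
      using dec unfolding Cons_triple decomposes_def by auto
    moreover have "{(\<rho>, u), (u, w)} \<subseteq> (path_links ?P Q)\<inverse>"
      unfolding Cons_triple by auto
    ultimately have "links t \<subseteq> path_links ?P Q \<union> (path_links ?P Q)\<inverse> \<union> ends ?P Q \<times> ends ?P Q"
      unfolding links by blast
    then show "parcs T \<subseteq> path_links ?P Q \<union> (path_links ?P Q)\<inverse> \<union> ends ?P Q \<times> ends ?P Q"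
      unfolding arcs by blast
    show "2 \<le> length ?P"
      using dec ws(2) unfolding decomposes_def by (cases P) auto
    show "ends ?P Q \<inter> leaves T = {}"
    proof (rule ccontr)
      assume "ends ?P Q \<inter> leaves T \<noteq> {}"
      then obtain v where v: "v \<in> ends ?P Q" "v \<in> leaves T"
        by blast
      have "(w, apex (hd us)) \<in> links t"
        unfolding links using ws(2) by auto
      then obtain c where c: "(v, c) \<in> links t"
        using v(1) dec unfolding Cons_triple decomposes_def links by blast
      then have "v \<notin> set (tips s)"
        using tip_no_child[OF d, of v c] by (auto simp: ts)
      with v(2) leaves have "v = \<rho>"
        by blast
      moreover have "v \<in> insert w (\<Union>t\<in>set us. set (nodes t))"
        using v(1) dec unfolding Cons_triple decomposes_def by (auto simp: cells_def ends_def)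
      ultimately show False
        using d unfolding t_eq by auto
    qed
  qed
qed

end
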